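(* In the non-linear regression setting $y_i=f(\theta^*,x_i)+\epsilon_i$ with costs in the finite set $\mathcal C=\{c_1<\dots<c_{|\mathcal C|}\}$ with probabilities $\pi_t$ (distribution $\mathcal F$) and residuals in $[L,U]$, consider the problem of minimizing the worst-case asymptotic mean-squared error of $\hat\theta_S$, namely the supremum (over the distribution of $x$ and the joint distribution $\mathcal D$ of $(c_i,\epsilon_i)$ with $\mathbb E[\epsilon_i]=0$) of the trace of the asymptotic covariance matrix $$\mathbb E\big[\nabla_\theta f(\theta^*,x_i)\nabla_\theta f(\theta^*,x_i)^\top\big]^{-1}\,\mathbb E\Big[\epsilon_i^2\frac{1\{i\in S\}}{A^2(c_i)}\Big],$$ over monotone non-increasing allocation rules $A$ with $\sum_t\pi_tc_tA_t\le\bar B$. After normalizing by the factor depending only on the distribution of $x$ (which does not depend on $A$), the analyst's optimization program is $$\begin{aligned}\inf_{A\in(0,1]^{|\mathcal C|}}\ \sup_{q\in[0,1]^{|\mathcal C|}}\ &\sum_{t=1}^{|\mathcal C|}\frac{\pi_t}{A_t}\big((1-q_t)L^2+q_tU^2\big)\\ \text{s.t. }&\sum_{t=1}^{|\mathcal C|}\pi_t\big((1-q_t)L+q_tU\big)=0,\\ &\sum_{t=1}^{|\mathcal C|}\pi_tc_tA_t\le\bar B,\\ &A\text{ is monotone non-increasing},\end{aligned}$$ i.e. for every $A\in(0,1]^{|\mathcal C|}$, $\sup_{\mathcal D}\mathbb E[\epsilon_i^2 1\{i\in S\}/A^2(c_i)]$ equals the inner supremum over those $q$ satisfying the first constrai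nt.
   Context: Agents are i.i.d. Agent $i$ has a cost $c_i\sim\mathcal F$ (known), features $x_i\in\mathbb R^d$ from an unknown distribution, and noise $\epsilon_i\in[L,U]$, $L\le0\le U$, $\mathbb E[\epsilon_i]=0$, possibly correlated with $c_i$; $x_i$ is independent of $(c_i,\epsilon_i)$. Given the costs, agent $i$ is in the elicited set $S$ with probability $A(c_i)$ independently of everything else; $A_t=A(c_t)$. The estimator is $\hat\theta_S=\operatorname{argmin}_{\theta\in\Theta}\sum_i\frac{1\{i\in S\}}{A(c_i)}(y_i-f(\theta,x_i))^2$ with $\Theta\subset\mathbb R^d$ compact and $\theta^*$ in its interior. The regression function is assumed to satisfy: $\theta\mapsto f(\theta,x)$ is twice continuously differentiable for every $x$; $\mathbb E_x[(f(\theta^*,x)-f(\theta,x))^2]>0$ for $\theta\neq\theta^*$; $\mathbb E[\nabla_\theta f(\theta^*,x_i)\nabla_\theta f(\theta^*,x_i)^\top]$ is positive-definite; $\|\nabla^2_{\theta\theta}(y_i-f(\theta,x_i))^2\|$ is dominated, uniformly over $\theta$ in a compact neighborhood of $\theta^*$, by a function with finite expectation. The supremum over $\mathcal D$ is over all joint distributions of $(c_i,\epsilon_i)$ with cost marginal $\mathcal F$, $\epsilon_i\in[L,U]$ and $\mathbb E[\epsilon_i]=0$. $\bar B$ is the average budget per agent. The factor depending on the distribution of $x$ is treated as a positive constant. *)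

theory Defs
  imports "HOL-Probability.Probability"
begin

definition gradient :: "(real^'d \<Rightarrow> real) \<Rightarrow> real^'d \<Rightarrow> real^'d" where
  "gradient g \<theta> = (\<chi> j. frechet_derivative g (at \<theta>) (axis j 1))"

definition hessian :: "(real^'d \<Rightarrow> real) \<Rightarrow> real^'d \<Rightarrow> real^'d^'d" where
  "hessian g \<theta> = matrix (frechet_derivative (gradient g) (at \<theta>))"

definition twice_cont_diff_on :: "(real^'d \<Rightarrow> real) \<Rightarrow> (real^'d) set \<Rightarrow> bool" where
  "twice_cont_diff_on g W \<longleftrightarrow>
     open W \<and> g differentiable_on W \<and> gradient g differentiable_on W \<and>
     continuous_on W (hessian g)"

definition outer :: "real^'d \<Rightarrow> real^'d^'d" where
  "outer v = (\<chi> i j. v $ i * v $ j)"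

definition pos_definite :: "real^'d^'d \<Rightarrow> bool" where
  "pos_definite M \<longleftrightarrow> transpose M = M \<and> (\<forall>v. v \<noteq> 0 \<longrightarrow> 0 < v \<bullet> (M *v v))"


text \<open>Costs are \<open>c 1 < \<dots> < c n\<close>, with probabilities \<open>\<pi> 1, \<dots>, \<pi> n\<close>. A law of (cost, noise) has
  cost marginal \<open>\<F>\<close> as soon as it gives each \<open>c t\<close> mass \<open>\<pi> t\<close>, because the \<open>\<pi> t\<close> sum to 1.\<close>

definition cost_noise_laws ::
  "nat \<Rightarrow> (nat \<Rightarrow> real) \<Rightarrow> (nat \<Rightarrow> real) \<Rightarrow> real \<Rightarrow> real \<Rightarrow> (real \<times> real) measure set" where
  "cost_noise_laws n c \<pi> L U =
     {D. prob_space D \<and> sets D = sets (borel \<Otimes>\<^sub>M borel) \<and>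
         (\<forall>t\<in>{1..n}. measure D {z. fst z = c t} = \<pi> t) \<and>
         (AE z in D. snd z \<in> {L..U}) \<and>
         (\<integral>z. snd z \<partial>D) = 0}"

text \<open>The allocation rule as a function of the cost: \<open>alloc n c A (c t) = A t\<close> for \<open>t \<in> {1..n}\<close>;
  the value 0 off the cost set is irrelevant.\<close>

definition alloc :: "nat \<Rightarrow> (nat \<Rightarrow> real) \<Rightarrow> (nat \<Rightarrow> real) \<Rightarrow> real \<Rightarrow> real" where
  "alloc n c A k = (\<Sum>t=1..n. A t * indicator {c t} k)"

text \<open>The law of \<open>(x\<^sub>i, ((c\<^sub>i, \<epsilon>\<^sub>i), i \<in> S))\<close> for one agent: \<open>x\<^sub>i \<sim> Q\<close> is independent of the rest,
  \<open>(c\<^sub>i, \<epsilon>\<^sub>i) \<sim> D\<close>, and given these the agent is selected with probability \<open>A(c\<^sub>i)\<close>.\<close>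

definition agent_law ::
  "nat \<Rightarrow> (nat \<Rightarrow> real) \<Rightarrow> (nat \<Rightarrow> real) \<Rightarrow> (real^'d) measure \<Rightarrow> (real \<times> real) measure
    \<Rightarrow> ((real^'d) \<times> (real \<times> real) \<times> bool) measure" where
  "agent_law n c A Q D =
     Q \<Otimes>\<^sub>M density (D \<Otimes>\<^sub>M count_space UNIV)
            (\<lambda>((k, e), s). ennreal (pmf (bernoulli_pmf (alloc n c A k)) s))"

text \<open>\<open>E[\<epsilon>\<^sub>i\<^sup>2 1{i \<in> S} / A(c\<^sub>i)\<^sup>2]\<close>\<close>

definition noise_moment ::
  "nat \<Rightarrow> (nat \<Rightarrow> real) \<Rightarrow> (nat \<Rightarrow> real) \<Rightarrow> (real^'d) measure \<Rightarrow> (real \<times> real) measure \<Rightarrow> real" where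
  "noise_moment n c A Q D =
     (\<integral>(x, (k, e), s). e\<^sup>2 * (of_bool s / (alloc n c A k)\<^sup>2) \<partial>agent_law n c A Q D)"

text \<open>\<open>E[\<nabla>f \<nabla>f\<^sup>T]\<^sup>-\<^sup>1 E[\<epsilon>\<^sub>i\<^sup>2 1{i \<in> S} / A(c\<^sub>i)\<^sup>2]\<close>, the covariance matrix of the limiting normal law of
  \<open>\<theta> \<mapsto> argmin \<Sum>\<^sub>i 1{i \<in> S} / A(c\<^sub>i) (y\<^sub>i - f(\<theta>, x\<^sub>i))\<^sup>2\<close>, taken here by its closed form.\<close>

definition asymptotic_cov ::
  "(real^'d \<Rightarrow> real^'d \<Rightarrow> real) \<Rightarrow> real^'d \<Rightarrow> nat \<Rightarrow> (nat \<Rightarrow> real) \<Rightarrow> (nat \<Rightarrow> real)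
    \<Rightarrow> (real^'d) measure \<Rightarrow> (real \<times> real) measure \<Rightarrow> real^'d^'d" where
  "asymptotic_cov f \<theta>s n c A Q D =
     noise_moment n c A Q D *\<^sub>R
     matrix_inv (\<integral>(x, _). outer (gradient (\<lambda>\<theta>. f \<theta> x) \<theta>s) \<partial>agent_law n c A Q D)"

definition feature_factor ::
  "(real^'d \<Rightarrow> real^'d \<Rightarrow> real) \<Rightarrow> real^'d \<Rightarrow> (real^'d) measure \<Rightarrow> real" where
  "feature_factor f \<theta>s Q = trace (matrix_inv (\<integral>x. outer (gradient (\<lambda>\<theta>. f \<theta> x) \<theta>s) \<partial>Q))"

text \<open>The norm of the library is the Frobenius norm; the choice does not matter, as all matrix norms are
  equivalent.\<close>

definition dominated_hessian ::
  "(real^'d \<Rightarrow> real^'d \<Rightarrow> real) \<Rightarrow> (real^'d) set \<Rightarrow> real^'d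
    \<Rightarrow> (real^'d) measure \<Rightarrow> (real \<times> real) measure \<Rightarrow> bool" where
  "dominated_hessian f \<Theta> \<theta>s Q D \<longleftrightarrow>
     (\<exists>K g. compact K \<and> \<theta>s \<in> interior K \<and> K \<subseteq> \<Theta> \<and> integrable (Q \<Otimes>\<^sub>M D) g \<and>
        (AE (x, k, e) in Q \<Otimes>\<^sub>M D. \<forall>\<theta>\<in>K.
           norm (hessian (\<lambda>\<theta>'. (f \<theta>s x + e - f \<theta>' x)\<^sup>2) \<theta>) \<le> g (x, k, e)))"

text \<open>The feature distributions that satisfy the regularity assumptions, whatever admissible law of
  (cost, noise) they are combined with. The identification condition uses the non-negative
  integral, under which an infinite expectation counts as positive.\<close>

definition feature_laws ::
  "(real^'d \<Rightarrow> real^'d \<Rightarrow> real) \<Rightarrow> (real^'d) set \<Rightarrow> real^'d \<Rightarrow> (real \<times> real) measure set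
    \<Rightarrow> (real^'d) measure set" where
  "feature_laws f \<Theta> \<theta>s \<D> =
     {Q. prob_space Q \<and> sets Q = sets borel \<and>
         (\<forall>\<theta>\<in>\<Theta>. \<theta> \<noteq> \<theta>s \<longrightarrow> 0 < (\<integral>\<^sup>+x. ennreal ((f \<theta>s x - f \<theta> x)\<^sup>2) \<partial>Q)) \<and>
         integrable Q (\<lambda>x. outer (gradient (\<lambda>\<theta>. f \<theta> x) \<theta>s)) \<and>
         pos_definite (\<integral>x. outer (gradient (\<lambda>\<theta>. f \<theta> x) \<theta>s) \<partial>Q) \<and>
         (\<forall>D\<in>\<D>. dominated_hessian f \<Theta> \<theta>s Q D)}"


definition allocations :: "nat \<Rightarrow> (nat \<Rightarrow> real) set" where
  "allocations n = {1..n} \<rightarrow>\<^sub>E {0<..1}"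

definition feasible_allocations ::
  "nat \<Rightarrow> (nat \<Rightarrow> real) \<Rightarrow> (nat \<Rightarrow> real) \<Rightarrow> real \<Rightarrow> (nat \<Rightarrow> real) set" where
  "feasible_allocations n c \<pi> B =
     {A \<in> allocations n. (\<Sum>t=1..n. \<pi> t * c t * A t) \<le> B \<and> antimono_on {1..n} A}"

definition noise_mixtures :: "nat \<Rightarrow> (nat \<Rightarrow> real) \<Rightarrow> real \<Rightarrow> real \<Rightarrow> (nat \<Rightarrow> real) set" where
  "noise_mixtures n \<pi> L U =
     {q \<in> {1..n} \<rightarrow>\<^sub>E {0..1}. (\<Sum>t=1..n. \<pi> t * ((1 - q t) * L + q t * U)) = 0}"

definition program_objective ::
  "nat \<Rightarrow> (nat \<Rightarrow> real) \<Rightarrow> real \<Rightarrow> real \<Rightarrow> (nat \<Rightarrow> real) \<Rightarrow> (nat \<Rightarrow> real) \<Rightarrow> real" where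
  "program_objective n \<pi> L U A q =
     (\<Sum>t=1..n. \<pi> t / A t * ((1 - q t) * L\<^sup>2 + q t * U\<^sup>2))"

end

theory Submission
  imports Defs
begin

text \<open>Inverse-propensity weighting turns the noise moment into \<open>E[\<epsilon>\<^sup>2 / A(c)]\<close>. On \<open>[L, U]\<close> the square lies
  below its chord, so given each cost, moving the noise to the endpoints while keeping its
  conditional mean only increases this moment; \<open>q t\<close> is the conditional mass at \<open>U\<close>.\<close>

section \<open>Trace of the inverse of a positive definite matrix\<close>

lemma trace_scaleR: "trace (k *\<^sub>R M) = k * trace (M :: real^'d^'d)"
  by (simp add: trace_def sum_distrib_left)

text \<open>Every diagonal entry of the inverse is itself a value of the quadratic form of
  \<open>M\<close>: if \<open>v\<close> solves \<open>M *v v = axis i 1\<close>, the entry at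
  \<open>i\<close> is \<open>v \<bullet> (M *v v)\<close>.\<close>

lemma trace_matrix_inv_pos:
  fixes M :: "real^'d^'d"
  assumes "pos_definite M"
  shows "0 < trace (matrix_inv M)"
proof -
  have pos: "0 < v \<bullet> (M *v v)" if "v \<noteq> 0" for v
    using assms that by (auto simp: pos_definite_def)
  have "\<forall>x. M *v x = 0 \<longrightarrow> x = 0"
    using pos by (metis inner_zero_right less_irrefl)
  then obtain N where "N ** M = mat 1"
    using matrix_left_invertible_ker by blast
  \<comment> \<open>\<open>matrix_inv\<close> is a choice, so its defining equation becomes
    available only once some inverse is exhibited. The trivial kernel yields a left inverse, which
    for a square matrix is two-sided.\<close>
  then have inv: "M ** matrix_inv M = mat 1"
    unfolding matrix_inv_def using matrix_left_right_inverse[of N M]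
    by (metis (mono_tags, lifting) someI_ex)
  have "0 < matrix_inv M $ i $ i" for i
  proof -
    define v where "v = matrix_inv M *v axis i 1"
    have Mv: "M *v v = axis i 1"
      unfolding v_def by (simp add: matrix_vector_mul_assoc inv)
    then have "v \<noteq> 0" by (auto simp: axis_eq_0_iff)
    then have "0 < v \<bullet> axis i 1" using pos Mv by metis
    then show ?thesis
      by (simp add: v_def inner_axis matrix_vector_mult_basis column_def)
  qed
  then show ?thesis
    by (auto simp: trace_def intro!: sum_pos)
qed

section \<open>Attaching a Bernoulli selection to a law\<close>

lemma nn_integral_selection:
  fixes a :: "'a \<Rightarrow> real" and h :: "'a \<times> bool \<Rightarrow> ennreal"
  assumes [measurable]: "a \<in> borel_measurable D"
      "h \<in> borel_measurable (D \<Otimes>\<^sub>M count_space UNIV)"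
    and a: "\<And>z. 0 \<le> a z" "\<And>z. a z \<le> 1"
  shows "(\<integral>\<^sup>+w. h w \<partial>density (D \<Otimes>\<^sub>M count_space UNIV)
            (\<lambda>(z, s). ennreal (pmf (bernoulli_pmf (a z)) s))) =
         (\<integral>\<^sup>+z. ennreal (a z) * h (z, True) + ennreal (1 - a z) * h (z, False) \<partial>D)"
proof -
  interpret C: sigma_finite_measure "count_space (UNIV :: bool set)"
    by (intro sigma_finite_measure_count_space_finite) simp
  \<comment> \<open>The mass function of \<open>bernoulli_pmf\<close> is \<open>a z\<close> and
    \<open>1 - a z\<close> only for parameters in the unit interval, hence the bounds on
    \<open>a\<close>. The explicit form is plainly measurable in the pair.\<close>
  have eq: "(\<lambda>(z, s). ennreal (pmf (bernoulli_pmf (a z)) s)) =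
      (\<lambda>w. ennreal (if snd w then a (fst w) else 1 - a (fst w)))"
    using a by (auto simp: fun_eq_iff)
  show ?thesis
    unfolding eq
    by (subst nn_integral_density, measurable, subst C.nn_integral_fst[symmetric], measurable)
       (auto intro!: nn_integral_cong simp: nn_integral_count_space_finite UNIV_bool add.commute)
qed

text \<open>The two weights \<open>a z\<close> and \<open>1 - a z\<close> add up to 1 at every
  point, so the total mass of \<open>D\<close> is preserved.\<close>

lemma prob_space_selection:
  fixes a :: "'a \<Rightarrow> real"
  assumes "prob_space D" "a \<in> borel_measurable D" "\<And>z. 0 \<le> a z" "\<And>z. a z \<le> 1"
  shows "prob_space (density (D \<Otimes>\<^sub>M count_space UNIV)
            (\<lambda>(z, s). ennreal (pmf (bernoulli_pmf (a z)) s)))" (is "prob_space ?N")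
proof (rule prob_spaceI)
  interpret D: prob_space D by fact
  have "emeasure ?N (space ?N) = (\<integral>\<^sup>+w. 1 \<partial>?N)" by simp
  also have "\<dots> = (\<integral>\<^sup>+z. ennreal (a z) * 1 + ennreal (1 - a z) * 1 \<partial>D)"
    using assms by (intro nn_integral_selection) auto
  also have "\<dots> = (\<integral>\<^sup>+z. 1 \<partial>D)"
    using assms by (intro nn_integral_cong) (simp flip: ennreal_plus)
  also have "\<dots> = 1" by (simp add: D.emeasure_space_1)
  finally show "emeasure ?N (space ?N) = 1" .
qed

section \<open>The allocation rule as a function of the cost\<close>

lemma measurable_alloc [measurable]: "alloc n c A \<in> borel_measurable borel"
  unfolding alloc_def[abs_def] by measurable

lemma alloc_cost:
  assumes "inj_on c {1..n}" "t \<in> {1..n}"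
  shows "alloc n c A (c t) = A t"
proof -
  have "alloc n c A (c t) = (\<Sum>s=1..n. if s = t then A s else 0)"
    unfolding alloc_def using assms
    by (intro sum.cong) (auto simp: indicator_def dest: inj_onD)
  then show ?thesis using assms by simp
qed

lemma alloc_outside: "k \<notin> c ` {1..n} \<Longrightarrow> alloc n c A k = 0"
  unfolding alloc_def by (intro sum.neutral) (auto simp: indicator_def)

lemma alloc_bounds:
  assumes "inj_on c {1..n}" "A \<in> allocations n"
  shows "0 \<le> alloc n c A k" "alloc n c A k \<le> 1"
proof -
  have "0 \<le> A t \<and> A t \<le> 1" if "t \<in> {1..n}" for t
    using PiE_mem[OF assms(2)[unfolded allocations_def] that] by simp
  then show "0 \<le> alloc n c A k" "alloc n c A k \<le> 1"
    using alloc_cost[OF assms(1)] alloc_outside[of k c n A] by (cases "k \<in> c ` {1..n}"; auto)+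
qed

text \<open>Inverse weighting splits into finitely many per-cost terms. The identity extends off the
  cost set because \<open>alloc\<close> is 0 there and division by zero gives 0, like the sum of
  vanishing indicators.\<close>

lemma divide_alloc:
  assumes "inj_on c {1..n}"
  shows "x / alloc n c A k = (\<Sum>t=1..n. (1 / A t) * (indicator {c t} k * x))"
proof (cases "k \<in> c ` {1..n}")
  case True
  then obtain s where s: "s \<in> {1..n}" "k = c s" by auto
  have "(\<Sum>t=1..n. (1 / A t) * (indicator {c t} k * x)) = (\<Sum>t=1..n. if t = s then x / A t else 0)"
    using s assms by (intro sum.cong) (auto simp: indicator_def dest: inj_onD)
  then show ?thesis using s alloc_cost[OF assms] by simp
next
  case False
  then have "(\<Sum>t=1..n. (1 / A t) * (indicator {c t} k * x)) = 0"
    by (intro sum.neutral) (auto simp: indicator_def)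
  with False show ?thesis by (simp add: alloc_outside)
qed

section \<open>Moments under the law of one agent\<close>

lemma agent_law_eq:
  "agent_law n c A Q D = Q \<Otimes>\<^sub>M density (D \<Otimes>\<^sub>M count_space UNIV)
     (\<lambda>(z, s). ennreal (pmf (bernoulli_pmf (alloc n c A (fst z))) s))"
  unfolding agent_law_def by (simp add: case_prod_beta')

lemma cost_noise_lawsD:
  assumes "D \<in> cost_noise_laws n c \<pi> L U"
  shows "prob_space D" "space D = UNIV"
  using assms sets_eq_imp_space_eq[of D "borel \<Otimes>\<^sub>M borel"]
  by (auto simp: cost_noise_laws_def space_pair_measure)

text \<open>Given cost and noise, the indicator of selection has expectation \<open>A(c)\<close>,
  which cancels one of the two factors in the denominator; the features integrate out.\<close>

lemma noise_moment_eq: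
  assumes inj: "inj_on c {1..n}" and A: "A \<in> allocations n"
    and D: "D \<in> cost_noise_laws n c \<pi> L U" and Q: "prob_space Q"
  shows "noise_moment n c A Q D = (\<integral>z. (snd z)\<^sup>2 / alloc n c A (fst z) \<partial>D)"
proof -
  note ab = alloc_bounds[OF inj A]
  note DM = cost_noise_lawsD[OF D]
  have [measurable_cong]: "sets D = sets (borel \<Otimes>\<^sub>M borel)"
    using D by (simp add: cost_noise_laws_def)
  define N where "N = density (D \<Otimes>\<^sub>M count_space (UNIV :: bool set))
     (\<lambda>(z, s). ennreal (pmf (bernoulli_pmf (alloc n c A (fst z))) s))"
  have [measurable_cong]: "sets N = sets ((borel \<Otimes>\<^sub>M borel) \<Otimes>\<^sub>M count_space UNIV)"
    unfolding N_def sets_density by (intro sets_pair_measure_cong) (simp_all add: \<open>sets D = _\<close>)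
  interpret Q: prob_space Q by fact
  interpret N: prob_space N
    unfolding N_def by (intro prob_space_selection DM(1) ab) measurable
  define h :: "(real \<times> real) \<times> bool \<Rightarrow> real" where
    "h w = (snd (fst w))\<^sup>2 * (of_bool (snd w) / (alloc n c A (fst (fst w)))\<^sup>2)" for w
  have [measurable]: "(\<lambda>w. of_bool (snd w) :: real) \<in> borel_measurable N"
    unfolding of_bool_def by measurable
  have [measurable]: "h \<in> borel_measurable N"
    unfolding h_def[abs_def] by measurable
  have h_nonneg: "0 \<le> h w" for w by (simp add: h_def)
  have "noise_moment n c A Q D = (\<integral>w. h (snd w) \<partial>(Q \<Otimes>\<^sub>M N))"
    by (simp add: noise_moment_def agent_law_eq N_def h_def case_prod_beta')
  \<comment> \<open>Both Bochner integrals have non-negative integrands, so they can be compared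
    through the non-negative integral without first establishing integrability.\<close>
  also have "\<dots> = enn2real (\<integral>\<^sup>+w. h (snd w) \<partial>(Q \<Otimes>\<^sub>M N))"
    by (intro integral_eq_nn_integral) (auto simp: h_nonneg)
  also have "(\<integral>\<^sup>+w. h (snd w) \<partial>(Q \<Otimes>\<^sub>M N)) = (\<integral>\<^sup>+w. h w \<partial>N)"
    by (subst N.nn_integral_fst[symmetric]) (auto simp: Q.emeasure_space_1)
  also have "\<dots> = (\<integral>\<^sup>+z. ennreal (alloc n c A (fst z)) * ennreal (h (z, True)) +
      ennreal (1 - alloc n c A (fst z)) * ennreal (h (z, False)) \<partial>D)"
    unfolding N_def
  proof (rule nn_integral_selection)
    have "measurable N borel = measurable (D \<Otimes>\<^sub>M count_space UNIV) (borel :: real measure)"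
      by (intro measurable_cong_sets) (simp_all add: N_def)
    then have [measurable]: "h \<in> borel_measurable (D \<Otimes>\<^sub>M count_space UNIV)"
      using \<open>h \<in> borel_measurable N\<close> by simp
    show "(\<lambda>w. ennreal (h w)) \<in> borel_measurable (D \<Otimes>\<^sub>M count_space UNIV)" by measurable
  qed (use ab in auto)
  \<comment> \<open>The unselected case contributes 0. The cancellation also holds where
    \<open>alloc\<close> vanishes, since both sides are then 0.\<close>
  also have "\<dots> = (\<integral>\<^sup>+z. ennreal ((snd z)\<^sup>2 / alloc n c A (fst z)) \<partial>D)"
    using ab by (intro nn_integral_cong)
      (auto simp: h_def power2_eq_square simp flip: ennreal_mult'')
  also have "enn2real \<dots> = (\<integral>z. (snd z)\<^sup>2 / alloc n c A (fst z) \<partial>D)"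
    by (intro integral_eq_nn_integral[symmetric]) (auto simp: ab)
  finally show ?thesis .
qed

text \<open>Selection preserves total mass, so the second factor of \<open>agent_law\<close> is a
  probability measure and the marginal of the first coordinate is \<open>Q\<close>.\<close>

lemma integral_agent_law_features:
  fixes g :: "real^'d \<Rightarrow> 'b :: {banach, second_countable_topology}"
  assumes inj: "inj_on c {1..n}" and A: "A \<in> allocations n"
    and D: "D \<in> cost_noise_laws n c \<pi> L U" and g: "g \<in> borel_measurable Q"
  shows "(\<integral>(x, _). g x \<partial>agent_law n c A Q D) = (\<integral>x. g x \<partial>Q)"
proof -
  note DM = cost_noise_lawsD[OF D]
  have [measurable_cong]: "sets D = sets (borel \<Otimes>\<^sub>M borel)"
    using D by (simp add: cost_noise_laws_def)
  define N where "N = density (D \<Otimes>\<^sub>M count_space (UNIV :: bool set))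
     (\<lambda>(z, s). ennreal (pmf (bernoulli_pmf (alloc n c A (fst z))) s))"
  interpret N: prob_space N
    unfolding N_def by (intro prob_space_selection DM(1) alloc_bounds[OF inj A]) measurable
  have "(\<integral>(x, _). g x \<partial>agent_law n c A Q D) = (\<integral>w. g (fst w) \<partial>(Q \<Otimes>\<^sub>M N))"
    by (simp add: agent_law_eq N_def case_prod_beta')
  also have "\<dots> = (\<integral>x. g x \<partial>distr (Q \<Otimes>\<^sub>M N) Q fst)"
    using g by (simp add: integral_distr)
  finally show ?thesis by (simp add: N.distr_pair_fst)
qed

section \<open>From a law to a mixture: the upper bound\<close>

lemma square_le_chord:
  fixes e :: real
  assumes "L \<le> e" "e \<le> U"
  shows "e\<^sup>2 \<le> (L + U) * e - L * U"
  using mult_nonneg_nonneg[of "e - L" "U - e"] assms by (simp add: power2_eq_square algebra_simps)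

text \<open>For each cost, the mixture reproduces the first moment of the noise. The constraint then
  says that these moments sum to the overall mean 0, and the chord bound compares the second moments
  cost by cost.\<close>

lemma noise_moment_le_objective:
  assumes inj: "inj_on c {1..n}" and A: "A \<in> allocations n"
    and D: "D \<in> cost_noise_laws n c \<pi> L U" and Q: "prob_space Q"
    and probs: "\<forall>t\<in>{1..n}. 0 \<le> \<pi> t" "(\<Sum>t=1..n. \<pi> t) = 1"
    and bounds: "L \<le> 0" "0 \<le> U"
  shows "\<exists>q\<in>noise_mixtures n \<pi> L U. noise_moment n c A Q D \<le> program_objective n \<pi> L U A q"
proof -
  interpret D: prob_space D using D by (simp add: cost_noise_laws_def)
  have sp: "space D = UNIV" by (rule cost_noise_lawsD[OF D])
  have [measurable_cong]: "sets D = sets (borel \<Otimes>\<^sub>M borel)"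
    and \<pi>: "\<And>t. t \<in> {1..n} \<Longrightarrow> measure D {z. fst z = c t} = \<pi> t"
    and supp: "AE z in D. snd z \<in> {L..U}"
    and mean: "(\<integral>z. snd z \<partial>D) = 0"
    using D by (auto simp: cost_noise_laws_def)
  define I :: "nat \<Rightarrow> real \<times> real \<Rightarrow> real" where "I t z = indicator {c t} (fst z)" for t z
  have [measurable]: "I t \<in> borel_measurable D" for t
    unfolding I_def[abs_def] by measurable
  \<comment> \<open>\<open>m t\<close> and \<open>v t\<close> are the first and second moments on
    the event that the cost is \<open>c t\<close>, not divided by its probability, which may be
    0.\<close>
  define m where "m t = (\<integral>z. I t z * snd z \<partial>D)" for t
  define v where "v t = (\<integral>z. I t z * (snd z)\<^sup>2 \<partial>D)" for t
  have intI: "integrable D (I t)" for t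
    by (rule D.integrable_const_bound[where B = 1]) (auto simp: I_def indicator_def)
  \<comment> \<open>Since \<open>L \<le> 0 \<le> U\<close>, both 0 and the noise lie in the
    interval, so the absolute value of the noise is at most its length \<open>U - L\<close>.\<close>
  have int1: "integrable D (\<lambda>z. I t z * snd z)" for t
  proof (rule D.integrable_const_bound[where B = "U - L"])
    show "AE z in D. norm (I t z * snd z) \<le> U - L"
      using supp by eventually_elim (use bounds in \<open>auto simp: I_def indicator_def\<close>)
  qed simp
  have int2: "integrable D (\<lambda>z. I t z * (snd z)\<^sup>2)" for t
  proof (rule D.integrable_const_bound[where B = "(U - L)\<^sup>2"])
    show "AE z in D. norm (I t z * (snd z)\<^sup>2) \<le> (U - L)\<^sup>2"
      using supp
    proof eventually_elim
      case (elim z)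
      then have "\<bar>snd z\<bar> \<le> \<bar>U - L\<bar>" using bounds by auto
      then have "(snd z)\<^sup>2 \<le> (U - L)\<^sup>2" by (simp only: abs_le_square_iff)
      then show ?case by (auto simp: I_def indicator_def)
    qed
  qed simp
  have \<pi>_eq: "(\<integral>z. I t z \<partial>D) = \<pi> t" if "t \<in> {1..n}" for t
  proof -
    have "(\<integral>z. I t z \<partial>D) = (\<integral>z. indicator {z. fst z = c t} z \<partial>D)"
      by (intro Bochner_Integration.integral_cong) (auto simp: I_def indicator_def)
    then show ?thesis using \<pi>[OF that] by (simp add: sp)
  qed
  have m_ge: "L * \<pi> t \<le> m t" if "t \<in> {1..n}" for t
  proof -
    have "(\<integral>z. L * I t z \<partial>D) \<le> m t"
      unfolding m_def
    proof (intro integral_mono_AE int1 integrable_mult_right intI)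
      show "AE z in D. L * I t z \<le> I t z * snd z"
        using supp by eventually_elim (auto simp: I_def indicator_def)
    qed
    then show ?thesis using \<pi>_eq[OF that] by simp
  qed
  have m_le: "m t \<le> U * \<pi> t" if "t \<in> {1..n}" for t
  proof -
    have "m t \<le> (\<integral>z. U * I t z \<partial>D)"
      unfolding m_def
    proof (intro integral_mono_AE int1 integrable_mult_right intI)
      show "AE z in D. I t z * snd z \<le> U * I t z"
        using supp by eventually_elim (auto simp: I_def indicator_def)
    qed
    then show ?thesis using \<pi>_eq[OF that] by simp
  qed
  have v_le: "v t \<le> (L + U) * m t - L * U * \<pi> t" if "t \<in> {1..n}" for t
  proof -
    have "v t \<le> (\<integral>z. (L + U) * (I t z * snd z) - L * U * I t z \<partial>D)"
      unfolding v_def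
    proof (intro integral_mono_AE int1 int2 Bochner_Integration.integrable_diff integrable_mult_right intI)
      show "AE z in D. I t z * (snd z)\<^sup>2 \<le> (L + U) * (I t z * snd z) - L * U * I t z"
        using supp by eventually_elim (auto simp: I_def indicator_def square_le_chord)
    qed
    also have "\<dots> = (L + U) * m t - L * U * \<pi> t"
      using int1 intI \<pi>_eq[OF that] by (simp add: m_def)
    finally show ?thesis .
  qed
  \<comment> \<open>The prescribed masses sum to 1, so almost surely the cost is one of the
    \<open>c t\<close> and the indicators \<open>I t\<close> form a partition of unity. This is what
    lets the \<open>m t\<close> add up to the mean of the noise.\<close>
  have total: "(\<integral>z. (\<Sum>t=1..n. I t z) \<partial>D) = 1"
    using \<pi>_eq probs(2) by (simp add: intI)
  \<comment> \<open>For the constant rule 1, \<open>divide_alloc\<close> expresses the sum of the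
    indicators as \<open>1 / alloc\<close>, which is 1 on the cost set and 0 off it.\<close>
  have sumI_le: "(\<Sum>t=1..n. I t z) \<le> 1" for z
    using divide_alloc[OF inj, where A = "\<lambda>_. 1" and k = "fst z" and x = 1]
      alloc_cost[OF inj, where A = "\<lambda>_. 1"] alloc_outside[of "fst z" c n "\<lambda>_. 1"]
    by (cases "fst z \<in> c ` {1..n}") (auto simp: I_def)
  have "(\<integral>z. 1 - (\<Sum>t=1..n. I t z) \<partial>D) = 0"
    using total by (simp add: intI D.prob_space)
  then have costs: "AE z in D. (\<Sum>t=1..n. I t z) = 1"
    by (subst (asm) integral_nonneg_eq_0_iff_AE) (use sumI_le in \<open>auto simp: intI\<close>)
  have sum_m: "(\<Sum>t=1..n. m t) = 0"
  proof -
    have "(\<Sum>t=1..n. m t) = (\<integral>z. (\<Sum>t=1..n. I t z) * snd z \<partial>D)"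
      unfolding m_def by (simp add: int1 sum_distrib_right)
    also have "\<dots> = (\<integral>z. snd z \<partial>D)"
      using costs by (intro integral_cong_AE) (auto elim!: eventually_mono)
    finally show ?thesis using mean by simp
  qed
  \<comment> \<open>The weight solves \<open>(1 - q t) * L + q t * U = m t / \<pi> t\<close>. In the
    degenerate cases \<open>\<pi> t = 0\<close> and \<open>L = U\<close> (both then being 0),
    \<open>m t\<close> vanishes and any weight would do; 0 is taken.\<close>
  define q where "q = (\<lambda>t\<in>{1..n}. if \<pi> t = 0 \<or> L = U then 0 else (m t / \<pi> t - L) / (U - L))"
  have q: "q t \<in> {0..1} \<and> \<pi> t * ((1 - q t) * L + q t * U) = m t" if t: "t \<in> {1..n}" for t
  proof (cases "\<pi> t = 0 \<or> L = U")
    case True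
    then have "m t = 0" using m_ge[OF t] m_le[OF t] bounds by auto
    then show ?thesis using True t bounds by (auto simp: q_def)
  next
    case False
    then have pos: "0 < \<pi> t" "0 < U - L" using probs(1) t bounds by force+
    then have "L \<le> m t / \<pi> t" "m t / \<pi> t \<le> U"
      using m_ge[OF t] m_le[OF t] by (auto simp: field_simps)
    moreover have "(1 - q t) * L + q t * U = L + q t * (U - L)" by (simp add: algebra_simps)
    moreover have "q t * (U - L) = m t / \<pi> t - L" using False t pos by (simp add: q_def)
    ultimately show ?thesis using False t pos by (simp add: q_def)
  qed
  have "q \<in> extensional {1..n}" by (simp add: q_def)
  then have "q \<in> noise_mixtures n \<pi> L U"
    using q sum_m by (auto simp: noise_mixtures_def PiE_def)
  moreover have "noise_moment n c A Q D \<le> program_objective n \<pi> L U A q"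
  proof -
    have "noise_moment n c A Q D = (\<integral>z. (\<Sum>t=1..n. (1 / A t) * (I t z * (snd z)\<^sup>2)) \<partial>D)"
      unfolding noise_moment_eq[OF inj A D Q] divide_alloc[OF inj] I_def ..
    also have "\<dots> = (\<Sum>t=1..n. (1 / A t) * v t)"
      unfolding v_def by (simp add: int2 del: times_divide_eq_left)
    also have "\<dots> \<le> program_objective n \<pi> L U A q"
      unfolding program_objective_def
    proof (rule sum_mono)
      fix t assume t: "t \<in> {1..n}"
      have "0 < A t" using A t by (auto simp: allocations_def PiE_iff)
      have "v t \<le> (L + U) * (\<pi> t * ((1 - q t) * L + q t * U)) - L * U * \<pi> t"
        using v_le[OF t] q[OF t] by simp
      \<comment> \<open>The chord agrees with the square at \<open>L\<close> and \<open>U\<close>,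
        so at a mixture of the endpoints it gives the same mixture of their squares.\<close>
      also have "\<dots> = \<pi> t * ((1 - q t) * L\<^sup>2 + q t * U\<^sup>2)"
        by (simp add: power2_eq_square algebra_simps)
      finally show "1 / A t * v t \<le> \<pi> t / A t * ((1 - q t) * L\<^sup>2 + q t * U\<^sup>2)"
        using \<open>0 < A t\<close> by (simp add: divide_right_mono)
    qed
    finally show ?thesis .
  qed
  ultimately show ?thesis by blast
qed

section \<open>From a mixture to a law: attainment\<close>

lemma noise_moment_attains_objective:
  assumes inj: "inj_on c {1..n}" and A: "A \<in> allocations n"
    and q: "q \<in> noise_mixtures n \<pi> L U" and Q: "prob_space Q"
    and probs: "\<forall>t\<in>{1..n}. 0 \<le> \<pi> t" "(\<Sum>t=1..n. \<pi> t) = 1"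
    and bounds: "L \<le> 0" "0 \<le> U"
  shows "\<exists>D\<in>cost_noise_laws n c \<pi> L U. noise_moment n c A Q D = program_objective n \<pi> L U A q"
proof -
  \<comment> \<open>The law is finitely supported: a cost index \<open>t\<close> is drawn with
    probability \<open>\<pi> t\<close>, then a coin of bias \<open>q t\<close> decides whether the
    noise is \<open>U\<close> or \<open>L\<close>.\<close>
  define S where "S = {1..n} \<times> (UNIV :: bool set)"
  define p where "p w = \<pi> (fst w) * (if snd w then q (fst w) else 1 - q (fst w))"
    for w :: "nat \<times> bool"
  define g where "g w = (c (fst w), if snd w then U else L)" for w :: "nat \<times> bool"
  define P where "P = point_measure S p"
  define D where "D = distr P (borel \<Otimes>\<^sub>M borel) g"
  have fin: "finite S" by (simp add: S_def)
  have p_nonneg: "0 \<le> p w" if "w \<in> S" for w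
    using that q probs(1) by (auto simp: p_def S_def noise_mixtures_def PiE_iff)
  have sum_S: "(\<Sum>w\<in>S. p w * k w) =
      (\<Sum>t=1..n. \<pi> t * ((1 - q t) * k (t, False) + q t * k (t, True)))" for k :: "nat \<times> bool \<Rightarrow> real"
    unfolding S_def sum.cartesian_product'
    by (intro sum.cong) (auto simp: p_def UNIV_bool algebra_simps)
  have "(\<Sum>w\<in>S. p w) = 1"
    using sum_S[of "\<lambda>_. 1"] probs(2) by simp
  then interpret P: prob_space P
    unfolding P_def using fin p_nonneg by (intro prob_space_point_measure) (auto simp: sum_ennreal)
  have [measurable]: "g \<in> measurable P (borel \<Otimes>\<^sub>M borel)"
    by (simp add: P_def space_pair_measure)
  \<comment> \<open>One formula for all expectations under \<open>D\<close>; the cost masses, the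
    mean and the noise moment are instances of it.\<close>
  have integral_D: "(\<integral>z. k z \<partial>D) =
      (\<Sum>t=1..n. \<pi> t * ((1 - q t) * k (c t, L) + q t * k (c t, U)))"
    if [measurable]: "k \<in> borel_measurable (borel \<Otimes>\<^sub>M borel)" for k :: "real \<times> real \<Rightarrow> real"
  proof -
    have "(\<integral>z. k z \<partial>D) = (\<integral>w. k (g w) \<partial>P)"
      unfolding D_def by (rule integral_distr) measurable
    also have "\<dots> = (\<Sum>w\<in>S. p w * k (g w))"
      unfolding P_def using fin p_nonneg by (subst lebesgue_integral_point_measure_finite) auto
    finally show ?thesis by (simp add: sum_S g_def)
  qed
  have D: "D \<in> cost_noise_laws n c \<pi> L U"
    unfolding cost_noise_laws_def
  proof (intro CollectI conjI ballI)
    show prob: "prob_space D" unfolding D_def by (rule P.prob_space_distr) measurable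
    show sets: "sets D = sets (borel \<Otimes>\<^sub>M borel)" by (simp add: D_def)
    show "measure D {z. fst z = c t} = \<pi> t" if t: "t \<in> {1..n}" for t
    proof -
      have "measure D {z. fst z = c t} = (\<integral>z. indicator {c t} (fst z) \<partial>D)"
      proof -
        have "(\<integral>z. indicator {c t} (fst z) \<partial>D) = (\<integral>z. indicator {z. fst z = c t} z \<partial>D :: real)"
          by (intro Bochner_Integration.integral_cong) (auto simp: indicator_def)
        then show ?thesis by (simp add: D_def space_pair_measure)
      qed
      also have "\<dots> = (\<Sum>s=1..n. \<pi> s * indicator {c t} (c s))"
        by (subst integral_D) (auto simp: algebra_simps)
      \<comment> \<open>Distinct indices have distinct costs, so no other index adds mass at
        \<open>c t\<close>.\<close>
      also have "\<dots> = (\<Sum>s=1..n. if s = t then \<pi> s else 0)"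
        using inj t by (intro sum.cong) (auto simp: indicator_def dest: inj_onD)
      finally show ?thesis using t by simp
    qed
    show "AE z in D. snd z \<in> {L..U}"
      unfolding D_def using bounds by (subst AE_distr_iff) (auto simp: g_def)
    show "(\<integral>z. snd z \<partial>D) = 0"
      using q by (subst integral_D) (auto simp: noise_mixtures_def)
  qed
  moreover have "noise_moment n c A Q D = program_objective n \<pi> L U A q"
    using inj by (subst noise_moment_eq[OF inj A D Q], subst integral_D)
      (auto simp: program_objective_def alloc_cost add_divide_distrib distrib_left intro!: sum.cong)
  ultimately show ?thesis using D by blast
qed

section \<open>Properties of the program and scaling of infima\<close>

lemma noise_mixtures_nonempty:
  assumes "(\<Sum>t=1..n. \<pi> t) = 1" "L \<le> 0" "0 \<le> U"
  shows "noise_mixtures n \<pi> L U \<noteq> {}"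
proof -
  \<comment> \<open>The same weight at every cost, chosen so that the endpoints average to 0. If
    \<open>L = U\<close>, both are 0 and division by zero gives the harmless value 0.\<close>
  define r where "r = - L / (U - L)"
  have "r \<in> {0..1}"
    using assms by (cases "U = L") (auto simp: r_def field_simps)
  moreover have "(1 - r) * L + r * U = 0"
    using assms by (cases "U = L") (auto simp: r_def field_simps)
  ultimately have "(\<lambda>t\<in>{1..n}. r) \<in> noise_mixtures n \<pi> L U"
    by (auto simp: noise_mixtures_def)
  then show ?thesis by blast
qed

lemma program_objective_nonneg:
  assumes "A \<in> allocations n" "q \<in> noise_mixtures n \<pi> L U" "\<forall>t\<in>{1..n}. 0 \<le> \<pi> t"
  shows "0 \<le> program_objective n \<pi> L U A q"
proof -
  have "0 < A t" "0 \<le> q t" "q t \<le> 1" "0 \<le> \<pi> t" if "t \<in> {1..n}" for t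
    using assms that by (auto simp: allocations_def noise_mixtures_def PiE_iff)
  then show ?thesis
    unfolding program_objective_def
    by (intro sum_nonneg mult_nonneg_nonneg divide_nonneg_pos add_nonneg_nonneg) auto
qed

text \<open>Scaling by a positive real preserves the order of the extended reals. An empty index
  set, which occurs when no allocation meets the budget, gives infinity on both sides.\<close>

lemma INF_ereal_cmult:
  fixes f :: "'a \<Rightarrow> ereal"
  assumes "0 < (k::real)"
  shows "(INF i\<in>I. ereal k * f i) = ereal k * (INF i\<in>I. f i)"
proof -
  have "(\<lambda>i. ereal k * f i) ` I = {ereal k * x |x. x \<in> f ` I}" by auto
  then show ?thesis using ereal_Inf_cmult[OF assms, of "\<lambda>x. x \<in> f ` I"] by simp
qed

section \<open>Reduction of the worst-case design problem to the program\<close>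

theorem lemma9:
  fixes f :: "real^'d \<Rightarrow> real^'d \<Rightarrow> real"
    and \<Theta> :: "(real^'d) set" and \<theta>s :: "real^'d"
    and n :: nat and c \<pi> :: "nat \<Rightarrow> real" and L U B :: real
  defines "\<D> \<equiv> cost_noise_laws n c \<pi> L U"
  defines "\<X> \<equiv> feature_laws f \<Theta> \<theta>s \<D>"
  assumes costs: "strict_mono_on {1..n} c"
    and probs: "\<forall>t\<in>{1..n}. 0 \<le> \<pi> t" "(\<Sum>t=1..n. \<pi> t) = 1"
    and bounds: "L \<le> 0" "0 \<le> U"
    and parameters: "compact \<Theta>" "\<theta>s \<in> interior \<Theta>"
    and f_measurable: "\<forall>\<theta>\<in>\<Theta>. f \<theta> \<in> borel_measurable borel"
    and f_smooth: "\<forall>x. \<exists>W. \<Theta> \<subseteq> W \<and> twice_cont_diff_on (\<lambda>\<theta>. f \<theta> x) W"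
    and features: "\<X> \<noteq> {}"
  shows
    "(\<forall>Q\<in>\<X>. 0 < feature_factor f \<theta>s Q \<and>
        (\<forall>A\<in>allocations n. \<forall>D\<in>\<D>.
           trace (asymptotic_cov f \<theta>s n c A Q D) = feature_factor f \<theta>s Q * noise_moment n c A Q D)) \<and>
     (\<forall>A\<in>allocations n. \<forall>Q\<in>\<X>.
        (SUP D\<in>\<D>. ereal (noise_moment n c A Q D)) =
        (SUP q\<in>noise_mixtures n \<pi> L U. ereal (program_objective n \<pi> L U A q))) \<and>
     (\<forall>A\<in>allocations n.
        (SUP Q\<in>\<X>. SUP D\<in>\<D>. ereal (trace (asymptotic_cov f \<theta>s n c A Q D))) =
        (SUP Q\<in>\<X>. ereal (feature_factor f \<theta>s Q)) *
        (SUP q\<in>noise_mixtures n \<pi> L U. ereal (program_objective n \<pi> L U A q))) \<and>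
     (\<forall>Q\<in>\<X>.
        (INF A\<in>feasible_allocations n c \<pi> B.
           SUP D\<in>\<D>. ereal (trace (asymptotic_cov f \<theta>s n c A Q D))) =
        ereal (feature_factor f \<theta>s Q) *
        (INF A\<in>feasible_allocations n c \<pi> B. SUP q\<in>noise_mixtures n \<pi> L U.
           ereal (program_objective n \<pi> L U A q))) \<and>
     (INF A\<in>feasible_allocations n c \<pi> B. SUP Q\<in>\<X>. SUP D\<in>\<D>.
        ereal (trace (asymptotic_cov f \<theta>s n c A Q D) / feature_factor f \<theta>s Q)) =
     (INF A\<in>feasible_allocations n c \<pi> B. SUP q\<in>noise_mixtures n \<pi> L U.
        ereal (program_objective n \<pi> L U A q))"
proof -
  have inj: "inj_on c {1..n}" by (rule strict_mono_on_imp_inj_on[OF costs])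
  have Q_prob: "prob_space Q" if "Q \<in> \<X>" for Q
    using that by (simp add: \<X>_def feature_laws_def)
  let ?V = "\<lambda>A. SUP q\<in>noise_mixtures n \<pi> L U. ereal (program_objective n \<pi> L U A q)"
  have factor: "0 < feature_factor f \<theta>s Q" if "Q \<in> \<X>" for Q
    using that by (auto simp: \<X>_def feature_laws_def feature_factor_def intro!: trace_matrix_inv_pos)
  have cov: "trace (asymptotic_cov f \<theta>s n c A Q D) = feature_factor f \<theta>s Q * noise_moment n c A Q D"
    if "Q \<in> \<X>" "A \<in> allocations n" "D \<in> \<D>" for Q A D
  proof -
    have "(\<lambda>x. outer (gradient (\<lambda>\<theta>. f \<theta> x) \<theta>s)) \<in> borel_measurable Q"
      using that(1) by (auto simp: \<X>_def feature_laws_def)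
    from integral_agent_law_features[OF inj that(2) that(3)[unfolded \<D>_def] this]
    show ?thesis
      by (simp only: asymptotic_cov_def feature_factor_def trace_scaleR mult.commute)
  qed
  have moment: "(SUP D\<in>\<D>. ereal (noise_moment n c A Q D)) = ?V A"
    if "A \<in> allocations n" "Q \<in> \<X>" for A Q
  \<comment> \<open>Each law is dominated by some mixture and each mixture is realized by some law,
    so the suprema agree.\<close>
  proof (rule antisym)
    show "(SUP D\<in>\<D>. ereal (noise_moment n c A Q D)) \<le> ?V A"
      using noise_moment_le_objective[OF inj that(1) _ Q_prob[OF that(2)] probs bounds]
      unfolding \<D>_def by (intro SUP_mono) (metis ereal_less_eq(3))
    show "?V A \<le> (SUP D\<in>\<D>. ereal (noise_moment n c A Q D))"
      using noise_moment_attains_objective[OF inj that(1) _ Q_prob[OF that(2)] probs bounds]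
      unfolding \<D>_def by (intro SUP_mono) (metis order_refl)
  qed
  have mixtures: "noise_mixtures n \<pi> L U \<noteq> {}"
    by (rule noise_mixtures_nonempty[OF probs(2) bounds])
  \<comment> \<open>Sign information for extended-real products: it allows \<open>?V A\<close> to be
    taken out of the supremum over feature laws.\<close>
  have V_nonneg: "0 \<le> ?V A" if "A \<in> allocations n" for A
  proof -
    obtain q where q: "q \<in> noise_mixtures n \<pi> L U" using mixtures by blast
    then show ?thesis
      by (rule SUP_upper2) (simp add: program_objective_nonneg[OF that q probs(1)])
  qed
  \<comment> \<open>Taking a factor out of a supremum over laws requires at least one law, as an
    empty supremum would be minus infinity. The constant rule 1 serves only to instantiate the
    attainment lemma.\<close>
  have laws: "\<D> \<noteq> {}"
  proof -
    obtain q where "q \<in> noise_mixtures n \<pi> L U" using mixtures by blast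
    moreover obtain Q where "Q \<in> \<X>" using features by blast
    moreover have "(\<lambda>t\<in>{1..n}. 1) \<in> allocations n" by (simp add: allocations_def)
    ultimately show ?thesis
      using noise_moment_attains_objective[OF inj _ _ Q_prob probs bounds] unfolding \<D>_def by blast
  qed
  have trace: "(SUP D\<in>\<D>. ereal (trace (asymptotic_cov f \<theta>s n c A Q D))) =
      ereal (feature_factor f \<theta>s Q) * ?V A"
    if "A \<in> allocations n" "Q \<in> \<X>" for A Q
  proof -
    have "(SUP D\<in>\<D>. ereal (trace (asymptotic_cov f \<theta>s n c A Q D))) =
        (SUP D\<in>\<D>. ereal (feature_factor f \<theta>s Q) * ereal (noise_moment n c A Q D))"
      using cov that by (intro SUP_cong) auto
    also have "\<dots> = ereal (feature_factor f \<theta>s Q) * (SUP D\<in>\<D>. ereal (noise_moment n c A Q D))"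
      using factor[OF that(2)] by (intro Sup_ereal_mult_left'[OF laws, symmetric]) simp
    finally show ?thesis by (simp only: moment[OF that])
  qed
  \<comment> \<open>The feature factors may be unbounded over \<open>\<X>\<close>, so the identity
    is one of extended reals; if \<open>?V A\<close> is 0, both sides are 0 even when the supremum
    of the factors is infinite.\<close>
  have worst_features: "(SUP Q\<in>\<X>. SUP D\<in>\<D>. ereal (trace (asymptotic_cov f \<theta>s n c A Q D))) =
      (SUP Q\<in>\<X>. ereal (feature_factor f \<theta>s Q)) * ?V A" if "A \<in> allocations n" for A
  proof -
    have "(SUP Q\<in>\<X>. SUP D\<in>\<D>. ereal (trace (asymptotic_cov f \<theta>s n c A Q D))) =
        (SUP Q\<in>\<X>. ?V A * ereal (feature_factor f \<theta>s Q))"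
      using trace that by (intro SUP_cong) (auto simp: mult.commute)
    also have "\<dots> = ?V A * (SUP Q\<in>\<X>. ereal (feature_factor f \<theta>s Q))"
      using features V_nonneg[OF that] factor by (intro SUP_ereal_mult_left) (auto intro: less_imp_le)
    finally show ?thesis by (simp add: mult.commute)
  qed
  have feasible: "A \<in> allocations n" if "A \<in> feasible_allocations n c \<pi> B" for A
    using that by (simp add: feasible_allocations_def)
  have best: "(INF A\<in>feasible_allocations n c \<pi> B.
        SUP D\<in>\<D>. ereal (trace (asymptotic_cov f \<theta>s n c A Q D))) =
      ereal (feature_factor f \<theta>s Q) * (INF A\<in>feasible_allocations n c \<pi> B. ?V A)"
    if "Q \<in> \<X>" for Q
  proof -
    have "(INF A\<in>feasible_allocations n c \<pi> B.
        SUP D\<in>\<D>. ereal (trace (asymptotic_cov f \<theta>s n c A Q D))) =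
      (INF A\<in>feasible_allocations n c \<pi> B. ereal (feature_factor f \<theta>s Q) * ?V A)"
      using trace that feasible by (intro INF_cong) auto
    then show ?thesis by (simp add: INF_ereal_cmult[OF factor[OF that]])
  qed
  \<comment> \<open>After division by its own feature factor, every feature law yields the same
    value \<open>?V A\<close>, so the supremum over the non-empty \<open>\<X>\<close> is that of a
    constant.\<close>
  have normalized: "(SUP Q\<in>\<X>. SUP D\<in>\<D>.
      ereal (trace (asymptotic_cov f \<theta>s n c A Q D) / feature_factor f \<theta>s Q)) = ?V A"
    if "A \<in> allocations n" for A
  proof -
    have "(SUP D\<in>\<D>. ereal (trace (asymptotic_cov f \<theta>s n c A Q D) / feature_factor f \<theta>s Q)) = ?V A"
      if Q: "Q \<in> \<X>" for Q
    proof -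
      have "(SUP D\<in>\<D>. ereal (trace (asymptotic_cov f \<theta>s n c A Q D) / feature_factor f \<theta>s Q)) =
          (SUP D\<in>\<D>. ereal (noise_moment n c A Q D))"
        using factor[OF Q] cov[OF Q \<open>A \<in> allocations n\<close>] by (intro SUP_cong) auto
      then show ?thesis using moment[OF \<open>A \<in> allocations n\<close> Q] by simp
    qed
    then show ?thesis using features by simp
  qed
  have "(INF A\<in>feasible_allocations n c \<pi> B. SUP Q\<in>\<X>. SUP D\<in>\<D>.
        ereal (trace (asymptotic_cov f \<theta>s n c A Q D) / feature_factor f \<theta>s Q)) =
      (INF A\<in>feasible_allocations n c \<pi> B. ?V A)"
    using normalized feasible by (intro INF_cong) auto
  then show ?thesis
    using factor cov moment worst_features best by blast
qed

end
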